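(* For each $t_0\in[0,h)$, the discrete hybrid system $(Y_{t_0+nh})_{n\in\mathbb{N}}$ has an invariant probability measure; that is, there is a Borel probability measure $\mu_{t_0}$ on $M\times S$ such that for every $n\in\mathbb{N}$ and every Borel set $A\subseteq M\times S$, $$\mu_{t_0}(A)=\int_{M\times S}\mathcal{P}(nh,Y,A)\,d\mu_{t_0}(Y).$$
   Context: $\mathbb{R}^+=[0,\infty)$ and $\mathbb{N}=\{0,1,2,\dots\}$. Let $M$ be a nonempty compact metric space, $S=\{s_1,\dots,s_{|S|}\}$ a nonempty finite discrete set, $h>0$. For each $s\in S$ let $\varphi_s:\mathbb{R}^+\times M\to M$ be a deterministic dynamical system: $\varphi_s(0,x)=x$, $\varphi_s(t+r,x)=\varphi_s(t,\varphi_s(r,x))$, and $x\mapsto\varphi_s(t,x)$ is continuous for each $t$. Let $(X_n)_{n\in\mathbb{N}}$ be an $S$-valued Markov chain with transition matrix $Q=(P_{i\to j})$, and let $Z_t=X_{\lfloor t/h\rfloor}$. The hybrid system is $Y_t=(x_t,Z_t)\in M\times S$, where the position $x_t$ starts at $x_0$ and evolves on each interval $[mh,(m+1)h]$ by the flow $\varphi_{X_m}$, i.e. $x_{mh+r}=\varphi_{X_m}(r,x_{mh})$ for $0\le r\le h$. The discrete hybrid system for $t_0$ is $(Y_{t_0+mh})_{m\in\mathbb{N}}$; $\mathcal{P}(nh,Y,\cdot)$ denotes its $n$-step transition probability, i.e. the law of $Y_{t_0+(m+n)h}$ given $Y_{t_0+mh}=Y$ (independent of $m$). Explicitly, from $(x,s_i)$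 the one-step transition leads to $\bigl(\varphi_{s_j}(t_0,\varphi_{s_i}(h-t_0,x)),s_j\bigr)$ with probability $P_{i\to j}$, $j=1,\dots,|S|$, and the $n$-step transition is the $n$-fold composition of this kernel. *)

theory Defs
  imports "HOL-Probability.Probability"
begin

definition dynamical_system :: "(real \<Rightarrow> 'm::topological_space \<Rightarrow> 'm) \<Rightarrow> bool" where
  "dynamical_system f \<longleftrightarrow>
     (\<forall>x. f 0 x = x) \<and>
     (\<forall>t\<ge>0. \<forall>r\<ge>0. \<forall>x. f (t + r) x = f t (f r x)) \<and>
     (\<forall>t\<ge>0. continuous_on UNIV (f t))"

text \<open>The transition matrix is given by its rows: \<open>pmf (P i) j\<close> is the probability of the
  transition from \<open>i\<close> to \<open>j\<close>. The initial distribution is arbitrary.\<close>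

locale markov_chain = prob_space \<Omega>
  for \<Omega> :: "'w measure" and X :: "nat \<Rightarrow> 'w \<Rightarrow> 's::finite" and P :: "'s \<Rightarrow> 's pmf" +
  assumes random_variable_X [measurable]: "X n \<in> \<Omega> \<rightarrow>\<^sub>M count_space UNIV"
    and markov_property:
      "\<P>(w in \<Omega>. \<forall>k\<le>n. X k w = i k) \<noteq> 0 \<Longrightarrow>
       \<P>(w in \<Omega>. X (Suc n) w = j \<bar> \<forall>k\<le>n. X k w = i k) = pmf (P (i n)) j"

text \<open>The hybrid system driven by a single realisation \<open>s\<close> of the chain: \<open>grid_position\<close> gives
  the position at the switching time \<open>m * h\<close>.\<close>

primrec grid_position :: "('s \<Rightarrow> real \<Rightarrow> 'm \<Rightarrow> 'm) \<Rightarrow> real \<Rightarrow> 'm \<Rightarrow> (nat \<Rightarrow> 's) \<Rightarrow> nat \<Rightarrow> 'm" where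
  "grid_position \<phi> h x0 s 0 = x0"
| "grid_position \<phi> h x0 s (Suc m) = \<phi> (s m) h (grid_position \<phi> h x0 s m)"

definition position :: "('s \<Rightarrow> real \<Rightarrow> 'm \<Rightarrow> 'm) \<Rightarrow> real \<Rightarrow> 'm \<Rightarrow> (nat \<Rightarrow> 's) \<Rightarrow> real \<Rightarrow> 'm" where
  "position \<phi> h x0 s t =
     (let m = nat \<lfloor>t / h\<rfloor> in \<phi> (s m) (t - real m * h) (grid_position \<phi> h x0 s m))"

definition hybrid_system ::
  "('s \<Rightarrow> real \<Rightarrow> 'm \<Rightarrow> 'm) \<Rightarrow> real \<Rightarrow> 'm \<Rightarrow> (nat \<Rightarrow> 'w \<Rightarrow> 's) \<Rightarrow> real \<Rightarrow> 'w \<Rightarrow> 'm \<times> 's" where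
  "hybrid_system \<phi> h x0 X t w =
     (position \<phi> h x0 (\<lambda>k. X k w) t, X (nat \<lfloor>t / h\<rfloor>) w)"

definition hybrid_step ::
  "('s \<Rightarrow> real \<Rightarrow> 'm \<Rightarrow> 'm) \<Rightarrow> real \<Rightarrow> ('s \<Rightarrow> 's pmf) \<Rightarrow> real \<Rightarrow> 'm \<times> 's \<Rightarrow> ('m \<times> 's) pmf" where
  "hybrid_step \<phi> h P t0 = (\<lambda>(x, i). map_pmf (\<lambda>j. (\<phi> j t0 (\<phi> i (h - t0) x), j)) (P i))"

text \<open>\<open>hybrid_transition \<phi> h P t0 n y\<close> is the \<open>n\<close>-step transition probability from the state \<open>y\<close>.\<close>

primrec hybrid_transition ::
  "('s \<Rightarrow> real \<Rightarrow> 'm \<Rightarrow> 'm) \<Rightarrow> real \<Rightarrow> ('s \<Rightarrow> 's pmf) \<Rightarrow> real \<Rightarrow> nat \<Rightarrow> 'm \<times> 's \<Rightarrow> ('m \<times> 's) pmf" where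
  "hybrid_transition \<phi> h P t0 0 y = return_pmf y"
| "hybrid_transition \<phi> h P t0 (Suc n) y =
     bind_pmf (hybrid_step \<phi> h P t0 y) (hybrid_transition \<phi> h P t0 n)"

lemma position_0:
  assumes "\<And>s. dynamical_system (\<phi> s)"
  shows "position \<phi> h x0 s 0 = x0"
  using assms by (simp add: position_def dynamical_system_def)

lemma position_grid:
  assumes "h > 0" and "\<And>s. dynamical_system (\<phi> s)"
  shows "position \<phi> h x0 s (real m * h) = grid_position \<phi> h x0 s m"
  using assms by (simp add: position_def dynamical_system_def)

lemma nat_floor_grid:
  fixes h r :: real
  assumes "h > 0" "0 \<le> r" "r < h"
  shows "nat \<lfloor>(real m * h + r) / h\<rfloor> = m"
proof -
  have "\<lfloor>(real m * h + r) / h\<rfloor> = int m"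
    using assms by (intro floor_unique) (auto simp: field_simps)
  then show ?thesis by simp
qed

lemma position_flow:
  assumes "h > 0" and "\<And>s. dynamical_system (\<phi> s)" and "0 \<le> r" "r \<le> h"
  shows "position \<phi> h x0 s (real m * h + r) = \<phi> (s m) r (position \<phi> h x0 s (real m * h))"
proof (cases "r = h")
  case True
  have "real m * h + r = real (Suc m) * h"
    using True by (simp add: algebra_simps)
  then have "position \<phi> h x0 s (real m * h + r) = position \<phi> h x0 s (real (Suc m) * h)"
    by (rule arg_cong)
  then show ?thesis
    unfolding position_grid[where \<phi> = \<phi>, OF assms(1,2)] using True by simp
next
  case False
  then show ?thesis
    using assms nat_floor_grid[of h r m] position_grid[where \<phi> = \<phi>, OF assms(1,2), of x0 s m]
    by (simp add: position_def Let_def)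
qed

lemma hybrid_system_grid:
  assumes "h > 0" and "\<And>s. dynamical_system (\<phi> s)" and "0 \<le> t0" "t0 < h"
  shows "hybrid_system \<phi> h x0 X (t0 + real m * h) w =
    (\<phi> (X m w) t0 (grid_position \<phi> h x0 (\<lambda>k. X k w) m), X m w)"
  using assms position_flow[where \<phi> = \<phi>, OF assms(1,2), of t0 x0 "\<lambda>k. X k w" m] nat_floor_grid[of h t0 m]
    position_grid[where \<phi> = \<phi>, OF assms(1,2), of x0 "\<lambda>k. X k w" m]
  by (simp add: hybrid_system_def add.commute)

lemma grid_position_cong:
  assumes "\<And>k. k < m \<Longrightarrow> s k = s' k"
  shows "grid_position \<phi> h x0 s m = grid_position \<phi> h x0 s' m"
  using assms by (induction m) auto

lemma hybrid_transition_Suc: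
  fixes P :: "'s::finite \<Rightarrow> 's pmf"
  shows "measure_pmf.prob (hybrid_transition \<phi> h P t0 (Suc n) (x, i)) A =
    (\<Sum>j\<in>UNIV. pmf (P i) j *
       measure_pmf.prob (hybrid_transition \<phi> h P t0 n (\<phi> j t0 (\<phi> i (h - t0) x), j)) A)"
proof -
  have "measure_pmf.prob (hybrid_transition \<phi> h P t0 (Suc n) (x, i)) A =
    (\<integral>j. measure_pmf.prob (hybrid_transition \<phi> h P t0 n (\<phi> j t0 (\<phi> i (h - t0) x), j)) A
       \<partial>measure_pmf (P i))"
    by (simp add: hybrid_step_def bind_map_pmf measure_pmf_bind)
      (subst measure_pmf.measure_bind[where N = "count_space UNIV"],
        auto simp: measure_pmf_in_subprob_algebra)
  also have "\<dots> = (\<Sum>j\<in>UNIV. measure_pmf.prob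
      (hybrid_transition \<phi> h P t0 n (\<phi> j t0 (\<phi> i (h - t0) x), j)) A * pmf (P i) j)"
    by (rule integral_measure_pmf_real) auto
  finally show ?thesis by (simp add: mult.commute)
qed

context markov_chain
begin

lemma prob_path_Suc:
  "\<P>(w in \<Omega>. \<forall>k\<le>Suc n. X k w = i k) =
   \<P>(w in \<Omega>. \<forall>k\<le>n. X k w = i k) * pmf (P (i n)) (i (Suc n))"
proof -
  have eq: "{w \<in> space \<Omega>. \<forall>k\<le>Suc n. X k w = i k} =
      {w \<in> space \<Omega>. X (Suc n) w = i (Suc n) \<and> (\<forall>k\<le>n. X k w = i k)}"
    by (auto simp: le_Suc_eq)
  show ?thesis
  proof (cases "\<P>(w in \<Omega>. \<forall>k\<le>n. X k w = i k) = 0")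
    case True
    have "\<P>(w in \<Omega>. \<forall>k\<le>Suc n. X k w = i k) \<le> \<P>(w in \<Omega>. \<forall>k\<le>n. X k w = i k)"
      by (intro finite_measure_mono) auto
    with True show ?thesis by (simp add: measure_le_0_iff)
  next
    case False
    from markov_property[OF False, of "i (Suc n)"] False show ?thesis
      unfolding eq by (simp add: cond_prob_def field_simps)
  qed
qed

lemma measurable_grid_position:
  "(\<lambda>w. grid_position \<phi> h x0 (\<lambda>k. X k w) m) \<in> \<Omega> \<rightarrow>\<^sub>M count_space UNIV"
proof (induction m)
  case 0
  then show ?case by simp
next
  case (Suc m)
  have "(\<lambda>w. \<phi> i h (grid_position \<phi> h x0 (\<lambda>k. X k w) m)) \<in> \<Omega> \<rightarrow>\<^sub>M count_space UNIV" for i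
    by (rule measurable_compose[OF Suc]) simp
  then show ?case
    by (auto intro: measurable_compose_countable[where g = "X m"])
qed

lemma measurable_hybrid_system:
  "hybrid_system \<phi> h x0 X t \<in> \<Omega> \<rightarrow>\<^sub>M count_space UNIV"
proof -
  let ?m = "nat \<lfloor>t / h\<rfloor>"
  have "(\<lambda>w. (\<phi> i (t - real ?m * h) (grid_position \<phi> h x0 (\<lambda>k. X k w) ?m), i))
      \<in> \<Omega> \<rightarrow>\<^sub>M count_space UNIV" for i
    by (rule measurable_compose[OF measurable_grid_position]) simp
  from measurable_compose_countable[where g = "X ?m", OF this] show ?thesis
    by (simp add: hybrid_system_def[abs_def] position_def Let_def)
qed

lemma hybrid_event [measurable]:
  "Measurable.pred \<Omega> (\<lambda>w. hybrid_system \<phi> h x0 X t w \<in> A)"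
  by (rule measurable_compose[OF measurable_hybrid_system]) simp

lemma prob_path_hybrid:
  assumes "h > 0" and "\<And>s. dynamical_system (\<phi> s)" and "0 \<le> t0" "t0 < h"
  shows "\<P>(w in \<Omega>. (\<forall>k\<le>m. X k w = i k) \<and> hybrid_system \<phi> h x0 X (t0 + real (m + n) * h) w \<in> A) =
    \<P>(w in \<Omega>. \<forall>k\<le>m. X k w = i k) *
    measure_pmf.prob (hybrid_transition \<phi> h P t0 n (\<phi> (i m) t0 (grid_position \<phi> h x0 i m), i m)) A"
proof (induction n arbitrary: m i)
  case 0
  have *: "hybrid_system \<phi> h x0 X (t0 + real m * h) w =
      (\<phi> (i m) t0 (grid_position \<phi> h x0 i m), i m)" if "\<forall>k\<le>m. X k w = i k" for w
    using that grid_position_cong[of m "\<lambda>k. X k w" i \<phi> h x0]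
    by (simp add: hybrid_system_grid[where \<phi> = \<phi>, OF assms])
  have "{w \<in> space \<Omega>. (\<forall>k\<le>m. X k w = i k) \<and>
      hybrid_system \<phi> h x0 X (t0 + real (m + 0) * h) w \<in> A} =
      (if (\<phi> (i m) t0 (grid_position \<phi> h x0 i m), i m) \<in> A
       then {w \<in> space \<Omega>. \<forall>k\<le>m. X k w = i k} else {})"
    using * by auto
  then show ?case by (simp add: indicator_def)
next
  case (Suc n)
  let ?Y = "hybrid_system \<phi> h x0 X"
  let ?T = "hybrid_transition \<phi> h P t0"
  let ?i = "\<lambda>j. i(Suc m := j)"
  define E where "E j = {w \<in> space \<Omega>. (\<forall>k\<le>Suc m. X k w = ?i j k) \<and>
      ?Y (t0 + real (Suc m + n) * h) w \<in> A}" for j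
  define x where "x = grid_position \<phi> h x0 i m"
  have g: "grid_position \<phi> h x0 (?i j) m = x" for j
    unfolding x_def by (rule grid_position_cong) auto
  have flow: "\<phi> (i m) (h - t0) (\<phi> (i m) t0 x) = \<phi> (i m) h x"
    using assms(2)[of "i m"] assms(3,4) unfolding dynamical_system_def
    by (metis diff_add_cancel diff_ge_0_iff_ge less_imp_le)
  have path: "\<P>(w in \<Omega>. \<forall>k\<le>m. X k w = ?i j k) = \<P>(w in \<Omega>. \<forall>k\<le>m. X k w = i k)" for j
    by (rule arg_cong[where f = prob]) auto
  have "{w \<in> space \<Omega>. (\<forall>k\<le>m. X k w = i k) \<and> ?Y (t0 + real (m + Suc n) * h) w \<in> A} = (\<Union>j. E j)"
    by (auto simp: E_def le_Suc_eq)
  moreover have "prob (\<Union>j. E j) = (\<Sum>j\<in>UNIV. prob (E j))"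
  proof (rule finite_measure_finite_Union)
    show "range E \<subseteq> events" unfolding E_def by auto
    show "disjoint_family E"
      by (auto simp: E_def disjoint_family_on_def)
  qed simp
  moreover have "prob (E j) = \<P>(w in \<Omega>. \<forall>k\<le>m. X k w = i k) * (pmf (P (i m)) j *
      measure_pmf.prob (?T n (\<phi> j t0 (\<phi> (i m) (h - t0) (\<phi> (i m) t0 x)), j)) A)" for j
    unfolding E_def Suc.IH prob_path_Suc path by (simp add: g[unfolded fun_upd_def] flow fun_upd_def)
  ultimately show ?case
    by (simp only: hybrid_transition_Suc sum_distrib_left x_def[symmetric])
qed

theorem hybrid_transition_probability:
  assumes "h > 0" and "\<And>s. dynamical_system (\<phi> s)" and "0 \<le> t0" "t0 < h"
    and "\<P>(w in \<Omega>. hybrid_system \<phi> h x0 X (t0 + real m * h) w = y) \<noteq> 0"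
  shows "\<P>(w in \<Omega>. hybrid_system \<phi> h x0 X (t0 + real (m + n) * h) w \<in> A \<bar>
      hybrid_system \<phi> h x0 X (t0 + real m * h) w = y) =
    measure_pmf.prob (hybrid_transition \<phi> h P t0 n y) A"
proof -
  let ?Y = "hybrid_system \<phi> h x0 X"
  define I where "I = {i \<in> PiE {..m} (\<lambda>_. UNIV). (\<phi> (i m) t0 (grid_position \<phi> h x0 i m), i m) = y}"
  have fin: "finite I"
    unfolding I_def by (simp add: finite_PiE)
  have decomp: "\<P>(w in \<Omega>. ?Y (t0 + real m * h) w = y \<and> Q w) =
      (\<Sum>i\<in>I. \<P>(w in \<Omega>. (\<forall>k\<le>m. X k w = i k) \<and> Q w))"
    if [measurable]: "Measurable.pred \<Omega> Q" for Q
  proof -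
    define E where "E i = {w \<in> space \<Omega>. (\<forall>k\<le>m. X k w = i k) \<and> Q w}" for i
    have cong: "grid_position \<phi> h x0 (restrict (\<lambda>k. X k w) {..m}) m =
        grid_position \<phi> h x0 (\<lambda>k. X k w) m" for w
      by (rule grid_position_cong) auto
    have "{w \<in> space \<Omega>. ?Y (t0 + real m * h) w = y \<and> Q w} = (\<Union>i\<in>I. E i)"
    proof (intro equalityI subsetI)
      fix w assume "w \<in> {w \<in> space \<Omega>. ?Y (t0 + real m * h) w = y \<and> Q w}"
      then have "restrict (\<lambda>k. X k w) {..m} \<in> I" "w \<in> E (restrict (\<lambda>k. X k w) {..m})"
        by (auto simp: I_def E_def cong hybrid_system_grid[where \<phi> = \<phi>, OF assms(1-4)])
      then show "w \<in> (\<Union>i\<in>I. E i)" by blast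
    next
      fix w assume "w \<in> (\<Union>i\<in>I. E i)"
      then obtain i where i: "i \<in> I" "w \<in> E i" by blast
      then have "grid_position \<phi> h x0 (\<lambda>k. X k w) m = grid_position \<phi> h x0 i m"
        by (intro grid_position_cong) (auto simp: E_def)
      with i show "w \<in> {w \<in> space \<Omega>. ?Y (t0 + real m * h) w = y \<and> Q w}"
        by (auto simp: I_def E_def hybrid_system_grid[where \<phi> = \<phi>, OF assms(1-4)])
    qed
    moreover have "prob (\<Union>i\<in>I. E i) = (\<Sum>i\<in>I. prob (E i))"
    proof (rule finite_measure_finite_Union[OF fin])
      show "E ` I \<subseteq> events" unfolding E_def by auto
      show "disjoint_family_on E I"
        unfolding disjoint_family_on_def
      proof (intro ballI impI)
        fix i j assume ij: "i \<in> I" "j \<in> I" "i \<noteq> j"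
        then obtain k where "k \<in> {..m}" "i k \<noteq> j k"
          using PiE_ext[of i "{..m}" "\<lambda>_. UNIV" j] unfolding I_def by blast
        then show "E i \<inter> E j = {}" by (auto simp: E_def)
      qed
    qed
    ultimately show ?thesis by (simp add: E_def)
  qed
  have "\<P>(w in \<Omega>. ?Y (t0 + real m * h) w = y \<and> ?Y (t0 + real (m + n) * h) w \<in> A) =
      (\<Sum>i\<in>I. \<P>(w in \<Omega>. \<forall>k\<le>m. X k w = i k) * measure_pmf.prob (hybrid_transition \<phi> h P t0 n y) A)"
    by (subst decomp) (auto simp: prob_path_hybrid[where \<phi> = \<phi>, OF assms(1-4)] I_def
        simp del: of_nat_add intro!: sum.cong)
  also have "\<dots> = \<P>(w in \<Omega>. ?Y (t0 + real m * h) w = y) *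
      measure_pmf.prob (hybrid_transition \<phi> h P t0 n y) A"
    using decomp[of "\<lambda>_. True"] by (simp add: sum_distrib_right)
  finally show ?thesis
    using assms(5) by (simp add: cond_prob_def conj_commute)
qed

end

end

theory Submission
  imports Defs
begin

text \<open>
  The proof is the Krylov--Bogoliubov argument without integration theory on \<open>C(M \<times> S)\<close>. The Cesaro
  averages of the laws of the chain, regarded as functions on all subsets of \<open>M \<times> S\<close>, have by
  Tychonov's theorem a pointwise limit point: a finitely additive, exactly invariant content \<open>m\<close>.
  Putting \<open>\<lambda>(U) = sup {m(C) | C \<subseteq> U closed}\<close> on open sets and extending by Caratheodory gives a Borel
  probability measure \<open>\<mu>\<close>. Preimages of closed sets under the continuous maps of the system are closed,
  so the invariance of \<open>m\<close> yields only \<open>\<mu>(U) \<le> (\<mu>P)(U)\<close> for open \<open>U\<close>; but for two probability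
  measures on a space whose closed sets are \<open>G\<^sub>\<delta>\<close> this already forces equality.
\<close>


section \<open>Pointwise limit points of bounded set functions\<close>

text \<open>Tychonov makes the cube \<open>[0,1]^'a\<close> compact. For an uncountable index type
  it may fail to be sequentially compact, so the limit is taken along a filter finer than
  \<open>sequentially\<close> instead of a subsequence.\<close>

lemma bounded_family_subnet_limit:
  fixes \<nu> :: "nat \<Rightarrow> 'a \<Rightarrow> real"
  assumes "\<And>n a. \<nu> n a \<in> {0..1}"
  obtains m F where "F \<noteq> bot" "F \<le> sequentially" "\<And>a. ((\<lambda>n. \<nu> n a) \<longlongrightarrow> m a) F"
proof -
  let ?K = "PiE UNIV (\<lambda>_. {0..1}) :: ('a \<Rightarrow> real) set"
  have "compactin (product_topology (\<lambda>_. euclidean) UNIV) ?K"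
    by (subst compactin_PiE) auto
  then have "compact ?K"
    by (simp add: euclidean_product_topology)
  moreover have "filtermap \<nu> sequentially \<noteq> bot"
    by (simp add: filtermap_bot_iff)
  moreover have "eventually (\<lambda>g. g \<in> ?K) (filtermap \<nu> sequentially)"
    using assms by (auto simp: eventually_filtermap PiE_iff)
  ultimately obtain m where m: "inf (nhds m) (filtermap \<nu> sequentially) \<noteq> bot"
    unfolding compact_filter by blast
  \<comment> \<open>This filter plays the role of a subnet: it keeps the indices at which
    \<open>\<nu> n\<close> is close to \<open>m\<close>, and it is proper because \<open>m\<close>
    is a cluster point.\<close>
  define F where "F = inf (filtercomap \<nu> (nhds m)) sequentially"
  have "F \<noteq> bot"
  proof
    assume "F = bot"
    then have "eventually (\<lambda>_. False) F" by simp
    then obtain Q R where "eventually Q (nhds m)" "eventually R sequentially" "\<And>n. Q (\<nu> n) \<Longrightarrow> R n \<Longrightarrow> False"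
      unfolding F_def eventually_inf eventually_filtercomap by blast
    then have "eventually (\<lambda>_. False) (inf (nhds m) (filtermap \<nu> sequentially))"
      unfolding eventually_inf eventually_filtermap
      by (intro exI[of _ Q] exI[of _ "\<lambda>g. \<not> Q g"]) (auto elim!: eventually_mono[of R])
    with m show False by (simp add: trivial_limit_def)
  qed
  moreover have "F \<le> sequentially" by (simp add: F_def)
  moreover have "((\<lambda>n. \<nu> n a) \<longlongrightarrow> m a) F" for a
  proof -
    have "filterlim \<nu> (nhds m) F"
      unfolding F_def filterlim_def filtermap_le_iff_le_filtercomap by simp
    moreover have "((\<lambda>g. g a) \<longlongrightarrow> m a) (nhds m)"
    proof (rule topological_tendstoI)
      fix S :: "real set" assume "open S" "m a \<in> S"
      moreover have "open ((\<lambda>g. g a) -` S :: ('a \<Rightarrow> real) set)"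
        using \<open>open S\<close> continuous_on_product_coordinates by (rule open_vimage)
      ultimately show "eventually (\<lambda>g. g a \<in> S) (nhds m)"
        using eventually_nhds_in_open[of "(\<lambda>g. g a) -` S" m] by simp
    qed
    ultimately show ?thesis
      by (rule filterlim_compose[rotated])
  qed
  ultimately show thesis using that by blast
qed

section \<open>From a finitely additive content to a Borel probability measure\<close>

text \<open>Closed sets are required to be zero sets, instead of working in a metric space, because
  \<open>'m \<times> 's\<close> has no \<open>metric_space\<close> instance when \<open>'s\<close> is merely of class \<open>discrete_topology\<close>.\<close>

locale compact_content =
  fixes m :: "'a::topological_space set \<Rightarrow> ennreal"
  assumes compact_UNIV: "compact (UNIV :: 'a set)"
    and zero_set: "closed F \<Longrightarrow> \<exists>f. continuous_on UNIV (f :: 'a \<Rightarrow> real) \<and> F = {x. f x = 0}"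
    and m_empty: "m {} = 0"
    and m_Un: "A \<inter> B = {} \<Longrightarrow> m (A \<union> B) = m A + m B"
    and m_UNIV: "m UNIV = 1"
begin

text \<open>The values of \<open>m\<close> on open sets need not be countably subadditive.
  Approximation from inside by closed, hence compact, sets repairs this.\<close>

definition inner_content :: "'a set \<Rightarrow> ennreal" where
  "inner_content U = (SUP C\<in>{C. closed C \<and> C \<subseteq> U}. m C)"

definition outer_content :: "'a set \<Rightarrow> ennreal" where
  "outer_content A = (INF U\<in>{U. open U \<and> A \<subseteq> U}. inner_content U)"

definition regular_extension :: "'a measure" where
  "regular_extension = measure_of UNIV (sets borel) outer_content"

lemma m_mono:
  assumes "A \<subseteq> B" shows "m A \<le> m B"
proof -
  have "m B = m A + m (B - A)" using m_Un[of A "B - A"] assms by (simp add: Un_absorb1)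
  then show ?thesis by simp
qed

lemma m_subadd: "m (A \<union> B) \<le> m A + m B"
  using m_Un[of A "B - A"] m_mono[of "B - A" B] by (simp add: add_left_mono)

lemma m_le_inner_content: "closed C \<Longrightarrow> C \<subseteq> U \<Longrightarrow> m C \<le> inner_content U"
  unfolding inner_content_def by (rule SUP_upper) simp

lemma inner_content_leI: "(\<And>C. closed C \<Longrightarrow> C \<subseteq> U \<Longrightarrow> m C \<le> b) \<Longrightarrow> inner_content U \<le> b"
  unfolding inner_content_def by (rule SUP_least) simp

lemma inner_content_mono: "U \<subseteq> V \<Longrightarrow> inner_content U \<le> inner_content V"
  by (intro inner_content_leI m_le_inner_content) auto

lemma inner_content_empty: "inner_content {} = 0"
  using inner_content_leI[of "{}" 0] m_empty by auto

lemma inner_content_add_leI: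
  assumes "\<And>C. closed C \<Longrightarrow> C \<subseteq> U \<Longrightarrow> m C + c \<le> b"
  shows "inner_content U + c \<le> b"
proof -
  have "inner_content U + c = (SUP C\<in>{C. closed C \<and> C \<subseteq> U}. m C + c)"
    unfolding inner_content_def by (rule ennreal_SUP_add_left[symmetric]) auto
  also have "\<dots> \<le> b" by (rule SUP_least) (simp add: assms)
  finally show ?thesis .
qed

text \<open>Normality follows from comparing \<open>\<bar>f\<bar>\<close> with
  \<open>\<bar>g\<bar>\<close>: where one function vanishes, the other does not.\<close>

lemma separation:
  fixes C D :: "'a set"
  assumes "closed C" "closed D" "C \<inter> D = {}"
  obtains V W where "open V" "open W" "C \<subseteq> V" "D \<subseteq> W" "V \<inter> W = {}"
proof -
  obtain f g where fg: "continuous_on UNIV (f :: 'a \<Rightarrow> real)" "C = {x. f x = 0}"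
      "continuous_on UNIV (g :: 'a \<Rightarrow> real)" "D = {x. g x = 0}"
    using zero_set assms by metis
  show thesis
  proof
    show "open {x. \<bar>f x\<bar> < \<bar>g x\<bar>}" "open {x. \<bar>g x\<bar> < \<bar>f x\<bar>}"
      using fg by (auto intro!: open_Collect_less continuous_intros)
  qed (use assms(3) fg in auto)
qed

text \<open>A closed \<open>C\<close> in the union is cut into two closed pieces, one in each open
  set. The sets \<open>C - U\<close> and \<open>C - V\<close> are disjoint; removing disjoint
  neighbourhoods \<open>A\<close>, \<open>B\<close> of them leaves \<open>C - A\<close> inside
  \<open>U\<close> and \<open>C - B\<close> inside \<open>V\<close>, which together cover
  \<open>C\<close>.\<close>

lemma inner_content_Un:
  assumes "open U" "open V"
  shows "inner_content (U \<union> V) \<le> inner_content U + inner_content V"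
proof (rule inner_content_leI)
  fix C assume C: "closed C" "C \<subseteq> U \<union> V"
  obtain A B where AB: "open A" "open B" "C - U \<subseteq> A" "C - V \<subseteq> B" "A \<inter> B = {}"
    using separation[of "C - U" "C - V"] C assms by (auto intro: closed_Diff)
  have "C = (C - A) \<union> (C - B)" using AB by blast
  then have "m C \<le> m (C - A) + m (C - B)" using m_subadd by metis
  also have "\<dots> \<le> inner_content U + inner_content V"
    using AB C by (intro add_mono m_le_inner_content closed_Diff) auto
  finally show "m C \<le> inner_content U + inner_content V" .
qed

text \<open>Compactness reduces a countable cover of \<open>C\<close> to a finite one; this is where
  finite additivity becomes countable subadditivity.\<close>

lemma inner_content_UN:
  fixes U :: "nat \<Rightarrow> 'a set"
  assumes U: "\<And>n. open (U n)"
  shows "inner_content (\<Union>n. U n) \<le> (\<Sum>n. inner_content (U n))"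
proof (rule inner_content_leI)
  fix C assume C: "closed C" "C \<subseteq> (\<Union>n. U n)"
  have "compact C" using compact_UNIV C(1) compact_Int_closed[of UNIV C] by simp
  then obtain I where I: "finite I" "C \<subseteq> (\<Union>n\<in>I. U n)"
    using compactE_image[of C UNIV U] U C by auto
  have "inner_content (\<Union>n\<in>I. U n) \<le> (\<Sum>n\<in>I. inner_content (U n))"
    using I(1)
  proof induction
    case empty then show ?case by (simp add: inner_content_empty)
  next
    case (insert i I)
    then show ?case
      using inner_content_Un[of "U i" "\<Union>n\<in>I. U n"] U
      by (auto intro: order_trans add_left_mono)
  qed
  also have "\<dots> \<le> (\<Sum>n. inner_content (U n))"
    using I(1) by (intro sum_le_suminf) auto
  finally show "m C \<le> (\<Sum>n. inner_content (U n))"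
    using m_le_inner_content[OF C(1) I(2)] by simp
qed

lemma outer_content_le: "open U \<Longrightarrow> A \<subseteq> U \<Longrightarrow> outer_content A \<le> inner_content U"
  unfolding outer_content_def by (rule INF_lower) simp

lemma outer_content_open:
  assumes "open U" shows "outer_content U = inner_content U"
  using assms outer_content_le[of U U] by (intro antisym) (auto simp: outer_content_def intro!: INF_greatest inner_content_mono)

lemma outer_content_mono: "A \<subseteq> B \<Longrightarrow> outer_content A \<le> outer_content B"
  unfolding outer_content_def by (rule INF_superset_mono) auto

lemma outer_content_close:
  assumes "outer_content A < b"
  obtains U where "open U" "A \<subseteq> U" "inner_content U < b"
  using assms unfolding outer_content_def INF_less_iff by auto

lemma outer_measure_space_outer_content: "outer_measure_space UNIV outer_content"
  unfolding outer_measure_space_def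
proof (intro conjI)
  show "positive UNIV outer_content"
    by (simp add: positive_def outer_content_open inner_content_empty)
  show "increasing UNIV outer_content"
    by (auto simp: increasing_def intro: outer_content_mono)
  show "countably_subadditive UNIV outer_content"
    unfolding countably_subadditive_def
  proof safe
    fix A :: "nat \<Rightarrow> 'a set"
    show "outer_content (\<Union>n. A n) \<le> (\<Sum>n. outer_content (A n))"
    proof (rule ennreal_le_epsilon)
      fix e :: real assume e: "0 < e" and fin: "(\<Sum>n. outer_content (A n)) < top"
      \<comment> \<open>The inequality is strict because finiteness of the sum makes each term
        finite.\<close>
      have "outer_content (A n) < outer_content (A n) + e * (1/2)^Suc n" for n
        using e ennreal_suminf_lessD[OF fin, of n] by (auto simp: less_top)
      then have "\<exists>U. open U \<and> A n \<subseteq> U \<and> inner_content U < outer_content (A n) + e * (1/2)^Suc n" for n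
        by (meson outer_content_close)
      then obtain U where U: "\<And>n. open (U n)" "\<And>n. A n \<subseteq> U n"
          "\<And>n. inner_content (U n) < outer_content (A n) + e * (1/2)^Suc n"
        by (metis outer_content_close)
      have "outer_content (\<Union>n. A n) \<le> inner_content (\<Union>n. U n)"
        using U by (intro outer_content_le) auto
      also have "\<dots> \<le> (\<Sum>n. inner_content (U n))" by (rule inner_content_UN) (rule U)
      also have "\<dots> \<le> (\<Sum>n. outer_content (A n) + e * (1/2)^Suc n)"
        using U(3) by (intro suminf_le) (auto intro: less_imp_le)
      also have "\<dots> = (\<Sum>n. outer_content (A n)) + (\<Sum>n. ennreal e * ennreal ((1/2) ^ Suc n))"
        using e by (subst suminf_add[symmetric])
          (auto simp del: ennreal_suminf_cmult simp add: ennreal_mult[symmetric])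
      also have "\<dots> = (\<Sum>n. outer_content (A n)) + e"
        unfolding ennreal_suminf_cmult
        by (subst suminf_ennreal_eq[OF zero_le_power power_half_series]) auto
      finally show "outer_content (\<Union>n. A n) \<le> (\<Sum>n. outer_content (A n)) + e" .
    qed
  qed
qed

text \<open>Caratheodory's condition for open sets comes from two nested approximations: a closed
  \<open>C\<close> inside \<open>V \<inter> U\<close>, then a closed \<open>D\<close> inside
  \<open>V - C\<close>, an open superset of \<open>V - U\<close>. They are disjoint subsets of
  \<open>V\<close>, so additivity of \<open>m\<close> applies.\<close>

lemma outer_content_split:
  assumes U: "open U"
  shows "outer_content (A \<inter> U) + outer_content (A - U) \<le> outer_content A"
  unfolding outer_content_def[of A]
proof (rule INF_greatest, clarify)
  fix V assume V: "open V" "A \<subseteq> V"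
  have "outer_content (A \<inter> U) + outer_content (A - U) \<le> inner_content (V \<inter> U) + outer_content (V - U)"
    using U V by (intro add_mono outer_content_le outer_content_mono) auto
  also have "\<dots> \<le> inner_content V"
  proof (rule inner_content_add_leI)
    fix C assume C: "closed C" "C \<subseteq> V \<inter> U"
    have "m C + outer_content (V - U) \<le> inner_content (V - C) + m C"
      using U V C by (subst add.commute, intro add_right_mono outer_content_le open_Diff) auto
    also have "\<dots> \<le> inner_content V"
    proof (rule inner_content_add_leI)
      fix D assume D: "closed D" "D \<subseteq> V - C"
      have "m D + m C = m (D \<union> C)" using D by (intro m_Un[symmetric]) auto
      also have "\<dots> \<le> inner_content V" using C D by (intro m_le_inner_content) auto
      finally show "m D + m C \<le> inner_content V" .
    qed
    finally show "m C + outer_content (V - U) \<le> inner_content V" .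
  qed
  finally show "outer_content (A \<inter> U) + outer_content (A - U) \<le> inner_content V" .
qed

text \<open>The Caratheodory-measurable sets form a sigma-algebra containing the open sets by
  \<open>outer_content_split\<close>, hence all Borel sets.\<close>

lemma measure_space_outer_content: "measure_space UNIV (sets borel) outer_content"
proof -
  interpret sigma_algebra UNIV "UNIV :: 'a set set"
    using sigma_algebra_Pow[of "UNIV :: 'a set"] by simp
  let ?L = "lambda_system UNIV (UNIV :: 'a set set) outer_content"
  have L: "measure_space UNIV ?L outer_content"
    by (rule caratheodory_lemma) (rule outer_measure_space_outer_content)
  have "subadditive UNIV outer_content"
    using outer_measure_space_outer_content countably_subadditive_subadditive
    unfolding outer_measure_space_def by blast
  then have "outer_content A \<le> outer_content (A \<inter> U) + outer_content (A - U)" for A U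
    using subadditiveD[of UNIV outer_content "A \<inter> U" "A - U"]
    by (simp add: Int_Diff_Un Int_Diff Diff_disjoint disjoint_iff)
  then have "{S. open S} \<subseteq> ?L"
    by (auto simp: lambda_system_eq intro!: antisym outer_content_split)
  then have "sets borel \<subseteq> ?L"
    using L unfolding borel_def measure_space_def
    by (simp add: sigma_algebra.sigma_sets_subset)
  with L show ?thesis
    using sets.sigma_algebra_axioms[of borel]
    by (auto simp: measure_space_def positive_def countably_additive_def subset_eq)
qed

lemma sets_regular_extension [simp, measurable_cong]: "sets regular_extension = sets borel"
  unfolding regular_extension_def
  by (metis sets_measure_of sets.sets_measure_of_eq sets.space_closed space_borel)

lemma space_regular_extension [simp]: "space regular_extension = UNIV"
  using sets_eq_imp_space_eq[OF sets_regular_extension] by simp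

lemma emeasure_regular_extension:
  assumes "A \<in> sets borel" shows "emeasure regular_extension A = outer_content A"
  using measure_space_outer_content assms
  by (simp add: regular_extension_def measure_space_def emeasure_measure_of_sigma)

lemma emeasure_regular_extension_open:
  "open U \<Longrightarrow> emeasure regular_extension U = inner_content U"
  by (simp add: emeasure_regular_extension outer_content_open)

text \<open>In the invariance proof \<open>C\<close> and \<open>U\<close> are preimages, under one
  map, of a closed set and an open set around it.\<close>

lemma m_le_regular_extension:
  assumes "closed C" "C \<subseteq> U" "open U"
  shows "m C \<le> emeasure regular_extension U"
  using assms by (simp add: emeasure_regular_extension_open m_le_inner_content)

lemma prob_space_regular_extension: "prob_space regular_extension"
proof
  have "inner_content UNIV = 1"
    using m_le_inner_content[of UNIV UNIV] inner_content_leI[of UNIV 1] m_mono[of _ UNIV] by (intro antisym) (auto simp: m_UNIV)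
  then show "emeasure regular_extension (space regular_extension) = 1"
    by (simp add: emeasure_regular_extension_open)
qed

end

section \<open>Comparison of probability measures on open sets\<close>

text \<open>The inequality passes to closed sets, which are decreasing intersections of open sets.
  Taking complements, with both total masses equal to 1, reverses it on open sets; these form an
  intersection-stable generator.\<close>

lemma prob_measure_eqI_open_le:
  fixes M N :: "'a::topological_space measure"
  assumes M: "prob_space M" "sets M = sets borel" and N: "prob_space N" "sets N = sets borel"
    and zero_set: "\<And>F :: 'a set. closed F \<Longrightarrow>
      \<exists>f. continuous_on UNIV (f :: 'a \<Rightarrow> real) \<and> F = {x. f x = 0}"
    and le: "\<And>U. open U \<Longrightarrow> emeasure M U \<le> emeasure N U"
  shows "M = N"
proof -
  interpret M: prob_space M by fact
  interpret N: prob_space N by fact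
  have space: "space M = UNIV" "space N = UNIV"
    using sets_eq_imp_space_eq[OF M(2)] sets_eq_imp_space_eq[OF N(2)] by simp_all
  have closed_le: "emeasure M F \<le> emeasure N F" if "closed F" for F
  proof -
    obtain f where f: "continuous_on UNIV (f :: 'a \<Rightarrow> real)" "F = {x. f x = 0}"
      using zero_set[OF \<open>closed F\<close>] by blast
    define U where "U n = {x. \<bar>f x\<bar> < inverse (real (Suc n))}" for n
    have U: "open (U n)" for n
      unfolding U_def by (intro open_Collect_less continuous_on_const continuous_on_rabs f(1))
    have "decseq U"
    proof (rule decseq_SucI)
      fix n
      have "inverse (real (Suc (Suc n))) \<le> inverse (real (Suc n))"
        by (intro le_imp_inverse_le) auto
      then show "U (Suc n) \<subseteq> U n"
        unfolding U_def using order.strict_trans2 by (intro Collect_mono impI)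
    qed
    have F: "F = (\<Inter>n. U n)"
    proof (intro equalityI subsetI)
      fix x assume x: "x \<in> (\<Inter>n. U n)"
      show "x \<in> F"
      proof (rule ccontr)
        assume "x \<notin> F"
        then have "0 < \<bar>f x\<bar>" by (simp add: f(2))
        then obtain n where "inverse (real (Suc n)) < \<bar>f x\<bar>"
          by (rule reals_Archimedean[THEN exE])
        moreover have "x \<in> U n" using x by (rule INT_D) (rule UNIV_I)
        ultimately show False unfolding U_def mem_Collect_eq by linarith
      qed
    next
      fix x assume "x \<in> F"
      then show "x \<in> (\<Inter>n. U n)" by (simp add: U_def f(2))
    qed
    have "(\<lambda>n. emeasure M (U n)) \<longlonglongrightarrow> emeasure M F"
      unfolding F using U M \<open>decseq U\<close> by (intro Lim_emeasure_decseq) auto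
    moreover have "(\<lambda>n. emeasure N (U n)) \<longlonglongrightarrow> emeasure N F"
      unfolding F using U N \<open>decseq U\<close> by (intro Lim_emeasure_decseq) auto
    ultimately show ?thesis
      using le U by (intro LIMSEQ_le) auto
  qed
  have "emeasure M U = emeasure N U" if "open U" for U
  proof (rule antisym)
    have "M.prob (- U) \<le> N.prob (- U)"
      using closed_le[of "- U"] that
      by (simp add: closed_Compl M.emeasure_eq_measure N.emeasure_eq_measure)
    then show "emeasure N U \<le> emeasure M U"
      using that M.prob_compl[of U] N.prob_compl[of U] M N
      by (simp add: M.emeasure_eq_measure N.emeasure_eq_measure space Compl_eq_Diff_UNIV)
  qed (rule le[OF that])
  then show ?thesis
    using M(2) N(2)
    by (intro measure_eqI_generator_eq[of "{S. open S}" UNIV M N "\<lambda>_. UNIV"])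
      (auto simp: Int_stable_def sets_borel M.emeasure_eq_measure)
qed

section \<open>Invariant measures for finitely many random continuous maps\<close>

text \<open>On the clopen set \<open>B c\<close> the map \<open>G c\<close> is applied with probability \<open>p c\<close>; different \<open>B c\<close> may
  overlap or coincide.\<close>

locale finite_random_maps =
  fixes \<kappa> :: "'a::topological_space \<Rightarrow> 'a pmf"
    and I :: "'c set" and p :: "'c \<Rightarrow> real" and B :: "'c \<Rightarrow> 'a set" and G :: "'c \<Rightarrow> 'a \<Rightarrow> 'a"
  assumes finite_I: "finite I"
    and p_nonneg: "\<And>c. c \<in> I \<Longrightarrow> 0 \<le> p c"
    and open_B: "\<And>c. c \<in> I \<Longrightarrow> open (B c)"
    and closed_B: "\<And>c. c \<in> I \<Longrightarrow> closed (B c)"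
    and continuous_G: "\<And>c. c \<in> I \<Longrightarrow> continuous_on UNIV (G c)"
    and prob_\<kappa>: "\<And>y A. measure_pmf.prob (\<kappa> y) A = (\<Sum>c\<in>I. p c * indicator (B c \<inter> G c -` A) y)"
begin

text \<open>One step acts on a law through its values at finitely many preimages. This formula makes
  sense for finitely additive contents and survives pointwise limits.\<close>

lemma prob_bind:
  "measure_pmf.prob (bind_pmf q \<kappa>) A = (\<Sum>c\<in>I. p c * measure_pmf.prob q (B c \<inter> G c -` A))"
proof -
  have "measure_pmf.prob (bind_pmf q \<kappa>) A = (\<integral>y. measure_pmf.prob (\<kappa> y) A \<partial>measure_pmf q)"
    unfolding measure_pmf_bind
    by (subst measure_pmf.measure_bind[where N = "count_space UNIV"])
      (auto simp: measure_pmf_in_subprob_algebra)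
  also have "\<dots> = (\<Sum>c\<in>I. \<integral>y. p c * indicator (B c \<inter> G c -` A) y \<partial>measure_pmf q)"
    unfolding prob_\<kappa>
    by (intro Bochner_Integration.integral_sum integrable_mult_right
        measure_pmf.integrable_const_bound[where B = 1]) auto
  finally show ?thesis by simp
qed

lemma emeasure_bind:
  "emeasure (bind_pmf q \<kappa>) A = (\<Sum>c\<in>I. ennreal (p c) * emeasure q (B c \<inter> G c -` A))"
  by (simp add: measure_pmf.emeasure_eq_measure prob_bind p_nonneg ennreal_mult sum_nonneg
      flip: sum_ennreal)

lemma borel_preimage:
  assumes "c \<in> I" "A \<in> sets borel" shows "B c \<inter> G c -` A \<in> sets borel"
proof -
  have "G c \<in> borel \<rightarrow>\<^sub>M borel"
    by (rule borel_measurable_continuous_onI) (rule continuous_G[OF assms(1)])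
  from measurable_sets[OF this assms(2)] show ?thesis
    using open_B[OF assms(1)] by auto
qed

theorem krylov_bogoliubov:
  assumes compact: "compact (UNIV :: 'a set)"
    and zero_set: "\<And>F :: 'a set. closed F \<Longrightarrow>
      \<exists>f. continuous_on UNIV (f :: 'a \<Rightarrow> real) \<and> F = {x. f x = 0}"
  obtains \<mu> :: "'a measure" where "prob_space \<mu>" "sets \<mu> = sets borel"
    "\<And>A. A \<in> sets borel \<Longrightarrow> emeasure \<mu> A = (\<Sum>c\<in>I. ennreal (p c) * emeasure \<mu> (B c \<inter> G c -` A))"
proof -
  \<comment> \<open>The law after \<open>k\<close> steps from an arbitrary starting point.\<close>
  define q where "q k = ((\<lambda>q. bind_pmf q \<kappa>) ^^ k) (return_pmf undefined)" for k
  have q_Suc: "q (Suc k) = bind_pmf (q k) \<kappa>" for k by (simp add: q_def)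
  define \<nu> where "\<nu> n A = (\<Sum>k<Suc n. measure_pmf.prob (q k) A) / real (Suc n)" for n A
  have "(\<Sum>k<Suc n. measure_pmf.prob (q k) A) \<le> (\<Sum>k<Suc n. 1)" for n A
    by (intro sum_mono) simp
  then have "\<nu> n A \<in> {0..1}" for n A
    by (auto simp: \<nu>_def divide_le_eq_1 sum_nonneg simp del: sum.lessThan_Suc)
  then obtain m F where F: "F \<noteq> bot" "F \<le> sequentially" and m: "\<And>A. ((\<lambda>n. \<nu> n A) \<longlongrightarrow> m A) F"
    using bounded_family_subnet_limit[of \<nu>] by blast
  have \<nu>_Un: "\<nu> n (A \<union> A') = \<nu> n A + \<nu> n A'" if "A \<inter> A' = {}" for n A A'
    using that by (simp add: \<nu>_def measure_pmf.finite_measure_Union sum.distrib add_divide_distrib)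
  \<comment> \<open>One step shifts the Cesaro average by one index, so the difference telescopes to
    its first and last terms.\<close>
  have \<nu>_step: "\<nu> n A - (\<Sum>c\<in>I. p c * \<nu> n (B c \<inter> G c -` A)) =
      (measure_pmf.prob (q 0) A - measure_pmf.prob (q (Suc n)) A) / real (Suc n)" for n A
  proof -
    have "(\<Sum>c\<in>I. p c * \<nu> n (B c \<inter> G c -` A)) = (\<Sum>k<Suc n. measure_pmf.prob (q (Suc k)) A) / real (Suc n)"
      unfolding \<nu>_def q_Suc prob_bind
      by (subst sum.swap) (simp only: sum_distrib_left sum_divide_distrib times_divide_eq_right)
    then show ?thesis
      using sum_lessThan_telescope'[of "\<lambda>k. measure_pmf.prob (q k) A" "Suc n"]
      by (simp only: \<nu>_def sum_subtractf flip: diff_divide_distrib)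
  qed
  have m_nonneg: "0 \<le> m A" for A
    using \<open>\<And>n A. \<nu> n A \<in> {0..1}\<close> by (intro tendsto_lowerbound[OF m _ F(1)]) auto
  have m_Un: "m (A \<union> A') = m A + m A'" if "A \<inter> A' = {}" for A A'
    using tendsto_unique[OF F(1) m[of "A \<union> A'"]] tendsto_add[OF m[of A] m[of A']]
    by (simp add: \<nu>_Un[OF that])
  have m_UNIV: "m UNIV = 1"
    using tendsto_unique[OF F(1) m[of UNIV], of 1] by (simp add: \<nu>_def)
  have m_step: "m A = (\<Sum>c\<in>I. p c * m (B c \<inter> G c -` A))" for A
  proof -
    have "(\<lambda>n. \<nu> n A - (\<Sum>c\<in>I. p c * \<nu> n (B c \<inter> G c -` A))) \<longlonglongrightarrow> 0"
    proof (rule Lim_null_comparison)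
      show "\<forall>\<^sub>F n in sequentially. norm (\<nu> n A - (\<Sum>c\<in>I. p c * \<nu> n (B c \<inter> G c -` A))) \<le> inverse (real (Suc n))"
      proof (rule always_eventually, rule allI)
        fix n
        have "\<bar>measure_pmf.prob (q 0) A - measure_pmf.prob (q (Suc n)) A\<bar> \<le> 1"
          using measure_pmf.prob_le_1[of "q 0" A] measure_pmf.prob_le_1[of "q (Suc n)" A]
            measure_nonneg[of "q 0" A] measure_nonneg[of "q (Suc n)" A] by linarith
        then show "norm (\<nu> n A - (\<Sum>c\<in>I. p c * \<nu> n (B c \<inter> G c -` A))) \<le> inverse (real (Suc n))"
          unfolding \<nu>_step by (simp add: divide_simps)
      qed
    qed (rule LIMSEQ_inverse_real_of_nat)
    \<comment> \<open>The defect is at most \<open>1 / (n + 1)\<close>, so it vanishes along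
      \<open>sequentially\<close> and hence along the finer filter \<open>F\<close>.\<close>
    then have "((\<lambda>n. \<nu> n A - (\<Sum>c\<in>I. p c * \<nu> n (B c \<inter> G c -` A))) \<longlongrightarrow> 0) F"
      by (rule tendsto_mono[OF F(2)])
    moreover have "((\<lambda>n. \<nu> n A - (\<Sum>c\<in>I. p c * \<nu> n (B c \<inter> G c -` A))) \<longlongrightarrow>
        m A - (\<Sum>c\<in>I. p c * m (B c \<inter> G c -` A))) F"
      by (intro tendsto_intros m)
    ultimately show ?thesis
      using tendsto_unique[OF F(1)] by fastforce
  qed
  interpret compact_content "\<lambda>A. ennreal (m A)"
  proof
    show "ennreal (m {}) = 0" using m_Un[of "{}" "{}"] by simp
  qed (use compact zero_set m_Un m_UNIV m_nonneg in auto)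
  define \<mu> where "\<mu> = regular_extension"
  have sets_\<mu>: "sets \<mu> = sets borel" by (simp add: \<mu>_def)
  define T where "T A = (\<Sum>c\<in>I. ennreal (p c) * emeasure \<mu> (B c \<inter> G c -` A))" for A
  \<comment> \<open>\<open>N\<close> is the image of \<open>\<mu>\<close> under one step of the chain\<close>
  define N where "N = measure_of UNIV (sets borel) T"
  have sa: "sigma_algebra UNIV (sets (borel :: 'a measure))"
    using sets.sigma_algebra_axioms[of "borel :: 'a measure"] by simp
  have "countably_additive (sets borel) T"
    unfolding countably_additive_def
  proof (intro allI impI)
    fix A :: "nat \<Rightarrow> 'a set"
    assume A: "range A \<subseteq> sets borel" "disjoint_family A"
    have "(\<Sum>n. T (A n)) = (\<Sum>c\<in>I. \<Sum>n. ennreal (p c) * emeasure \<mu> (B c \<inter> G c -` A n))"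
      unfolding T_def by (rule suminf_sum) simp
    also have "\<dots> = (\<Sum>c\<in>I. ennreal (p c) * emeasure \<mu> (\<Union>n. B c \<inter> G c -` A n))"
    proof (intro sum.cong refl)
      fix c assume "c \<in> I"
      then have "(\<Sum>n. emeasure \<mu> (B c \<inter> G c -` A n)) = emeasure \<mu> (\<Union>n. B c \<inter> G c -` A n)"
        using A borel_preimage
        by (intro suminf_emeasure) (auto simp: sets_\<mu> disjoint_family_on_def)
      then show "(\<Sum>n. ennreal (p c) * emeasure \<mu> (B c \<inter> G c -` A n)) =
          ennreal (p c) * emeasure \<mu> (\<Union>n. B c \<inter> G c -` A n)"
        by simp
    qed
    also have "\<dots> = T (\<Union>n. A n)"
      by (simp add: T_def vimage_UN)
    finally show "(\<Sum>n. T (A n)) = T (\<Union>n. A n)" .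
  qed
  then have N: "emeasure N A = T A" if "A \<in> sets borel" for A
    unfolding N_def using that
    by (intro emeasure_measure_of_sigma[OF sa]) (auto simp: positive_def T_def)
  have sets_N: "sets N = sets borel"
    using sigma_algebra.sets_measure_of_eq[OF sa] by (simp add: N_def)
  have le: "emeasure \<mu> U \<le> emeasure N U" if U: "open U" for U
  proof -
    \<comment> \<open>Exact invariance of \<open>m\<close> is applied to \<open>C\<close>; each
      preimage of \<open>C\<close> is closed and lies in the open preimage of \<open>U\<close>. The
      supremum over \<open>C\<close> then gives the claim.\<close>
    have "ennreal (m C) \<le> T U" if C: "closed C" "C \<subseteq> U" for C
    proof -
      have "ennreal (m C) = (\<Sum>c\<in>I. ennreal (p c) * ennreal (m (B c \<inter> G c -` C)))"
        by (subst m_step) (simp add: p_nonneg m_nonneg ennreal_mult sum_nonneg flip: sum_ennreal)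
      also have "\<dots> \<le> T U"
        unfolding T_def \<mu>_def
        using U C open_B closed_B continuous_G
        by (intro sum_mono mult_left_mono m_le_regular_extension closed_Int open_Int
            closed_vimage open_vimage) auto
      finally show ?thesis .
    qed
    then show ?thesis
      using U by (simp add: N \<mu>_def emeasure_regular_extension_open inner_content_leI)
  qed
  have prob_\<mu>: "prob_space \<mu>"
    unfolding \<mu>_def by (rule prob_space_regular_extension)
  interpret \<mu>: prob_space \<mu> by (rule prob_\<mu>)
  \<comment> \<open>The total mass of \<open>N\<close> is 1 because at every \<open>y\<close> the
    weights \<open>p c\<close> with \<open>y \<in> B c\<close> sum to the mass of
    \<open>\<kappa> y\<close>.\<close>
  have "T UNIV = (\<integral>\<^sup>+y. (\<Sum>c\<in>I. ennreal (p c) * indicator (B c) y) \<partial>\<mu>)"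
  proof -
    have "B c \<in> sets \<mu>" if "c \<in> I" for c
      using open_B[OF that] sets_\<mu> by simp
    then show ?thesis
      unfolding T_def by (subst nn_integral_sum) (simp_all add: nn_integral_cmult_indicator)
  qed
  also have "\<dots> = (\<integral>\<^sup>+y. ennreal (measure_pmf.prob (\<kappa> y) UNIV) \<partial>\<mu>)"
    unfolding prob_\<kappa>
    by (simp add: p_nonneg ennreal_mult ennreal_indicator flip: sum_ennreal)
  also have "\<dots> = 1" by (simp add: \<mu>.emeasure_space_1)
  finally have "prob_space N"
    using sets_eq_imp_space_eq[OF sets_N] N[of UNIV] by (intro prob_spaceI) simp
  then have "\<mu> = N"
    using prob_\<mu> sets_\<mu> sets_N zero_set le by (intro prob_measure_eqI_open_le)
  then show thesis
    using that[OF prob_\<mu> sets_\<mu>] N by (simp add: T_def)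
qed

end

section \<open>The product with a discrete space and the hybrid kernel\<close>

text \<open>Singletons of a discrete space are open, so a preimage is a union of open slices
  \<open>W \<times> {i}\<close>.\<close>

lemma continuous_on_Times_discrete:
  fixes f :: "'a::topological_space \<times> 's::discrete_topology \<Rightarrow> 'b::topological_space"
  assumes "\<And>i. continuous_on UNIV (\<lambda>x. f (x, i))"
  shows "continuous_on UNIV f"
  unfolding continuous_on_open_vimage[OF open_UNIV]
proof safe
  fix V :: "'b set" assume "open V"
  then have "open (\<Union>i. ((\<lambda>x. f (x, i)) -` V) \<times> {i})"
    using assms by (intro open_UN ballI open_Times open_vimage discrete_topology_class.open_discrete) auto
  also have "(\<Union>i. ((\<lambda>x. f (x, i)) -` V) \<times> {i}) = f -` V \<inter> UNIV"
    by auto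
  finally show "open (f -` V \<inter> UNIV)" .
qed

text \<open>On each sheet \<open>'m \<times> {i}\<close> the distance to the slice of
  \<open>F\<close> serves, and continuity is needed only sheet by sheet.\<close>

lemma zero_set_Times_discrete:
  fixes F :: "('m::metric_space \<times> 's::discrete_topology) set"
  assumes "closed F"
  shows "\<exists>f. continuous_on UNIV (f :: 'm \<times> 's \<Rightarrow> real) \<and> F = {y. f y = 0}"
proof -
  define S where "S i = (\<lambda>x. (x, i)) -` F" for i
  have S: "closed (S i)" for i
    unfolding S_def by (intro closed_vimage assms continuous_intros)
  \<comment> \<open>\<open>infdist x {} = 0\<close>, so empty slices need a separate value\<close>
  define f where "f = (\<lambda>(x, i). if S i = {} then 1 else infdist x (S i))"
  have "continuous_on UNIV f"
  proof (rule continuous_on_Times_discrete)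
    fix i
    show "continuous_on UNIV (\<lambda>x. f (x, i))"
      by (cases "S i = {}") (auto simp: f_def intro!: continuous_intros)
  qed
  moreover have "f (x, i) = 0 \<longleftrightarrow> (x, i) \<in> F" for x i
    using in_closed_iff_infdist_zero[OF S[of i], of x] by (auto simp: f_def S_def)
  then have "F = {y. f y = 0}" by auto
  ultimately show ?thesis by blast
qed

lemma hybrid_transition_0: "hybrid_transition \<phi> h P t0 0 = return_pmf"
  by (rule ext) simp

text \<open>The definition peels off the first step; \<open>emeasure_bind\<close> and the induction
  for invariance need the last step to be the one peeled off.\<close>

lemma hybrid_transition_Suc_right:
  "hybrid_transition \<phi> h P t0 (Suc n) y =
    bind_pmf (hybrid_transition \<phi> h P t0 n y) (hybrid_step \<phi> h P t0)"
proof (induction n arbitrary: y)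
  case 0
  show ?case by (simp add: hybrid_transition_0 bind_return_pmf bind_return_pmf')
next
  case (Suc n)
  have IH: "hybrid_transition \<phi> h P t0 (Suc n) =
      (\<lambda>z. bind_pmf (hybrid_transition \<phi> h P t0 n z) (hybrid_step \<phi> h P t0))"
    by (rule ext) (rule Suc)
  have "hybrid_transition \<phi> h P t0 (Suc (Suc n)) y =
      bind_pmf (hybrid_step \<phi> h P t0 y) (hybrid_transition \<phi> h P t0 (Suc n))"
    by (rule hybrid_transition.simps(2))
  also have "\<dots> = bind_pmf (bind_pmf (hybrid_step \<phi> h P t0 y) (hybrid_transition \<phi> h P t0 n))
      (hybrid_step \<phi> h P t0)"
    by (simp only: IH bind_assoc_pmf)
  also have "bind_pmf (hybrid_step \<phi> h P t0 y) (hybrid_transition \<phi> h P t0 n) =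
      hybrid_transition \<phi> h P t0 (Suc n) y"
    by (rule hybrid_transition.simps(2)[symmetric])
  finally show ?case .
qed

theorem corollary16:
  fixes \<phi> :: "'s::{finite,discrete_topology} \<Rightarrow> real \<Rightarrow> 'm::metric_space \<Rightarrow> 'm"
    and P :: "'s \<Rightarrow> 's pmf"
    and X :: "nat \<Rightarrow> 'w \<Rightarrow> 's"
    and \<Omega> :: "'w measure"
    and h t0 :: real
  assumes "compact (UNIV :: 'm set)"
    and "h > 0"
    and "\<And>s. dynamical_system (\<phi> s)"
    and "markov_chain \<Omega> X P"
    and "0 \<le> t0" and "t0 < h"
  shows "\<exists>\<mu> :: ('m \<times> 's) measure. prob_space \<mu> \<and> sets \<mu> = sets borel \<and>
    (\<forall>n. \<forall>A\<in>sets borel.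
       emeasure \<mu> A = (\<integral>\<^sup>+ y. emeasure (hybrid_transition \<phi> h P t0 n y) A \<partial>\<mu>))"
proof -
  \<comment> \<open>The index \<open>(i, j)\<close> stands for the transition from \<open>i\<close>
    to \<open>j\<close>. \<open>G\<close> ignores the discrete component of its argument;
    \<open>B\<close> restricts it to the sheet of \<open>i\<close>, where it is the actual
    motion.\<close>
  define p where "p = (\<lambda>(i, j). pmf (P i) j)"
  define B where "B = (\<lambda>(i, j :: 's). UNIV \<times> {i} :: ('m \<times> 's) set)"
  define G where "G = (\<lambda>(i, j) (x, k :: 's). (\<phi> j t0 (\<phi> i (h - t0) x), j))"
  interpret finite_random_maps "hybrid_step \<phi> h P t0" UNIV p B G
  proof
    show "open (B c)" "closed (B c)" "0 \<le> p c" for c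
      by (auto simp: B_def p_def split_beta
          intro!: open_Times discrete_topology_class.open_discrete closed_Times)
    show "continuous_on UNIV (G c)" for c
    proof (rule continuous_on_Times_discrete)
      fix k
      have "continuous_on UNIV (\<phi> s t)" if "0 \<le> t" for s t
        using assms(3) that by (simp add: dynamical_system_def)
      then show "continuous_on UNIV (\<lambda>x. G c (x, k))"
        using assms(5,6)
        by (auto simp: G_def split_beta intro!: continuous_intros
            intro: continuous_on_compose2[of UNIV "\<phi> (snd c) t0"])
    qed
    show "measure_pmf.prob (hybrid_step \<phi> h P t0 y) A =
        (\<Sum>c\<in>UNIV. p c * indicator (B c \<inter> G c -` A) y)" for y A
    proof (cases y)
      case (Pair x k)
      have "measure_pmf.prob (hybrid_step \<phi> h P t0 y) A =
          (\<Sum>j\<in>UNIV. pmf (P k) j * indicator A (\<phi> j t0 (\<phi> k (h - t0) x), j))"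
        using hybrid_transition_Suc[of \<phi> h P t0 0 x k A]
        by (simp add: Pair hybrid_transition_0 bind_return_pmf')
      \<comment> \<open>Only \<open>i = k\<close> contributes, since \<open>y\<close> lies on the
        sheet of \<open>k\<close>.\<close>
      also have "\<dots> = (\<Sum>i\<in>UNIV. \<Sum>j\<in>UNIV. p (i, j) * indicator (B (i, j) \<inter> G (i, j) -` A) y)"
        by (subst sum.remove[of _ k])
          (auto simp: p_def B_def G_def Pair indicator_def intro!: sum.cong)
      also have "\<dots> = (\<Sum>c\<in>UNIV. p c * indicator (B c \<inter> G c -` A) y)"
        using sum.cartesian_product[of "\<lambda>i j. p (i, j) * indicator (B (i, j) \<inter> G (i, j) -` A) y"
            UNIV UNIV]
        by (simp only: split_def prod.collapse UNIV_Times_UNIV)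
      finally show ?thesis .
    qed
  qed simp
  have "compact (UNIV :: ('m \<times> 's) set)"
    using compact_Times[OF assms(1) finite_imp_compact[of "UNIV :: 's set"]] by simp
  then obtain \<mu> :: "('m \<times> 's) measure" where \<mu>: "prob_space \<mu>" "sets \<mu> = sets borel"
    "\<And>A. A \<in> sets borel \<Longrightarrow>
      emeasure \<mu> A = (\<Sum>c\<in>UNIV. ennreal (p c) * emeasure \<mu> (B c \<inter> G c -` A))"
    using krylov_bogoliubov zero_set_Times_discrete by blast
  let ?T = "hybrid_transition \<phi> h P t0"
  \<comment> \<open>Measurability is carried through the induction because exchanging the integral
    with the finite sum requires it. In the step, one-step invariance turns \<open>A\<close> into
    its preimages, to which the induction hypothesis applies.\<close>
  have "(\<lambda>y. emeasure (?T n y) A) \<in> borel_measurable \<mu> \<and>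
      emeasure \<mu> A = (\<integral>\<^sup>+ y. emeasure (?T n y) A \<partial>\<mu>)" if "A \<in> sets borel" for n A
    using that
  proof (induction n arbitrary: A)
    case 0
    then show ?case using \<mu>(2) by simp
  next
    case (Suc n)
    have IH: "(\<lambda>y. emeasure (?T n y) (B c \<inter> G c -` A)) \<in> borel_measurable \<mu>"
        "emeasure \<mu> (B c \<inter> G c -` A) = (\<integral>\<^sup>+ y. emeasure (?T n y) (B c \<inter> G c -` A) \<partial>\<mu>)" for c
      using Suc.IH[OF borel_preimage[OF UNIV_I Suc.prems]] by auto
    show ?case
      unfolding hybrid_transition_Suc_right emeasure_bind \<mu>(3)[OF Suc.prems] IH(2)
      using IH(1) by (simp add: nn_integral_sum nn_integral_cmult)
  qed
  with \<mu> show ?thesis by blast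
qed

end
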